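(* Let $\varepsilon\in(0,1)$ and let $\rho,\sigma\in\mathfrak{D}(A)$ be density operators on a finite-dimensional Hilbert space $A$. For any $\alpha\in(0,1)$, $$D_H^{\varepsilon}(\rho\|\sigma)\;\geq\;\bar D_\alpha(\rho\|\sigma)+\frac{\alpha}{1-\alpha}\left(\frac{h(\alpha)}{\alpha}-\log\left(\frac1\varepsilon\right)\right),$$ where $h(\alpha)=-\alpha\log\alpha-(1-\alpha)\log(1-\alpha)$ is the binary entropy.
   Context: All Hilbert spaces are finite-dimensional, $\mathfrak{D}(A)$ is the set of density operators on $A$, and $\log$ is base two. For $\alpha\in(0,1)$ the Petz Rényi divergence is $\bar D_\alpha(\rho\|\sigma)=\frac{1}{\alpha-1}\log\operatorname{Tr}[\rho^\alpha\sigma^{1-\alpha}]$ (with value $+\infty$ if the trace is $0$). The quantum hypothesis testing relative entropy is $D_H^\varepsilon(\rho\|\sigma)=-\log\inf\{\operatorname{Tr}[\Pi\sigma]:0\le\Pi\le I,\ \operatorname{Tr}[\Pi\rho]\ge 1-\varepsilon\}$, with $-\log 0=+\infty$. *)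

theory Defs
  imports "HOL-Analysis.Analysis"
begin

text \<open>A finite-dimensional Hilbert space is represented in coordinates with respect to an
  orthonormal basis, as \<open>complex^'n\<close> for a finite index type \<open>'n\<close>; operators are square matrices.
  The library inner product on \<open>complex^'n\<close> is the real one, so the sesquilinear form
  (antilinear in the first argument) is defined here.\<close>

definition cinner_vec :: "complex^'n \<Rightarrow> complex^'n \<Rightarrow> complex" where
  "cinner_vec v w = (\<Sum>i\<in>UNIV. cnj (v $ i) * w $ i)"

definition adjoint_mat :: "complex^'n^'m \<Rightarrow> complex^'m^'n" where
  "adjoint_mat A = (\<chi> i j. cnj (A $ j $ i))"

definition hermitian :: "complex^'n^'n \<Rightarrow> bool" where
  "hermitian A \<longleftrightarrow> adjoint_mat A = A"

definition unitary :: "complex^'n^'n \<Rightarrow> bool" where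
  "unitary U \<longleftrightarrow> adjoint_mat U ** U = mat 1 \<and> U ** adjoint_mat U = mat 1"

definition psd :: "complex^'n^'n \<Rightarrow> bool" where
  "psd A \<longleftrightarrow> hermitian A \<and> (\<forall>v. 0 \<le> Re (cinner_vec v (A *v v)))"

definition loewner_le :: "complex^'n^'n \<Rightarrow> complex^'n^'n \<Rightarrow> bool" where
  "loewner_le A B \<longleftrightarrow> psd (B - A)"

definition density_op :: "complex^'n^'n \<Rightarrow> bool" where
  "density_op \<rho> \<longleftrightarrow> psd \<rho> \<and> trace \<rho> = 1"

definition real_diag :: "('n \<Rightarrow> real) \<Rightarrow> complex^'n^'n" where
  "real_diag d = (\<chi> i j. if i = j then complex_of_real (d i) else 0)"

definition spectral_decomp :: "complex^'n^'n \<Rightarrow> complex^'n^'n \<Rightarrow> ('n \<Rightarrow> real) \<Rightarrow> bool" where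
  "spectral_decomp A U d \<longleftrightarrow> unitary U \<and> A = U ** real_diag d ** adjoint_mat U"

text \<open>Functional calculus: \<open>f\<close> is applied to the eigenvalues of a Hermitian matrix. A
  decomposition exists by the spectral theorem, and the result does not depend on which one is
  chosen; see \<open>herm_fun_eq\<close>. On matrices that are not Hermitian the value is unspecified.\<close>

definition herm_fun :: "(real \<Rightarrow> real) \<Rightarrow> complex^'n^'n \<Rightarrow> complex^'n^'n" where
  "herm_fun f A =
     (THE B. \<exists>U d. spectral_decomp A U d \<and> B = U ** real_diag (\<lambda>i. f (d i)) ** adjoint_mat U)"

lemma real_diag_mult_left: "(real_diag d ** W) $ i $ j = complex_of_real (d i) * W $ i $ j"
  unfolding matrix_matrix_mult_def real_diag_def by (simp add: if_distrib if_distribR cong: if_cong)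

lemma real_diag_mult_right: "(W ** real_diag d) $ i $ j = W $ i $ j * complex_of_real (d j)"
  unfolding matrix_matrix_mult_def real_diag_def by (simp add: if_distrib if_distribR cong: if_cong)

lemma spectral_decomp_fun_unique:
  assumes "spectral_decomp A U d" and "spectral_decomp A V e"
  shows "U ** real_diag (\<lambda>i. f (d i)) ** adjoint_mat U
       = V ** real_diag (\<lambda>i. f (e i)) ** adjoint_mat V"
proof -
  have U: "adjoint_mat U ** U = mat 1" "U ** adjoint_mat U = mat 1"
    and V: "adjoint_mat V ** V = mat 1" "V ** adjoint_mat V = mat 1"
    and eq: "U ** real_diag d ** adjoint_mat U = V ** real_diag e ** adjoint_mat V"
    using assms by (auto simp: spectral_decomp_def unitary_def)
  define W where "W = adjoint_mat V ** U"
  have "W ** real_diag d = adjoint_mat V ** (U ** real_diag d ** adjoint_mat U) ** U"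
    unfolding W_def by (metis U(1) matrix_mul_assoc matrix_mul_rid)
  also have "\<dots> = real_diag e ** W"
    unfolding eq W_def by (metis V(1) matrix_mul_assoc matrix_mul_lid)
  finally have comm: "W $ i $ j * complex_of_real (d j) = complex_of_real (e i) * W $ i $ j" for i j
    by (metis real_diag_mult_left real_diag_mult_right)
  have "W $ i $ j = 0 \<or> d j = e i" for i j
    using comm[of i j] by (simp add: mult.commute)
  then have "W $ i $ j * complex_of_real (f (d j)) = complex_of_real (f (e i)) * W $ i $ j" for i j
    by (metis mult.commute mult_zero_left)
  then have "W ** real_diag (\<lambda>i. f (d i)) = real_diag (\<lambda>i. f (e i)) ** W"
    by (simp add: vec_eq_iff real_diag_mult_left real_diag_mult_right)
  then have "V ** (W ** real_diag (\<lambda>i. f (d i))) ** adjoint_mat U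
           = V ** (real_diag (\<lambda>i. f (e i)) ** W) ** adjoint_mat U"
    by simp
  moreover have "V ** (W ** real_diag (\<lambda>i. f (d i))) ** adjoint_mat U
      = U ** real_diag (\<lambda>i. f (d i)) ** adjoint_mat U"
    unfolding W_def by (metis V(2) matrix_mul_assoc matrix_mul_lid)
  moreover have "V ** (real_diag (\<lambda>i. f (e i)) ** W) ** adjoint_mat U
      = V ** real_diag (\<lambda>i. f (e i)) ** adjoint_mat V"
    unfolding W_def by (metis U(2) matrix_mul_assoc matrix_mul_rid)
  ultimately show ?thesis by simp
qed

lemma herm_fun_eq:
  assumes "spectral_decomp A U d"
  shows "herm_fun f A = U ** real_diag (\<lambda>i. f (d i)) ** adjoint_mat U"
  unfolding herm_fun_def
  by (rule the_equality) (use assms spectral_decomp_fun_unique in blast)+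

text \<open>Only used for positive semidefinite matrices and exponents in the open unit interval,
  where \<open>0 powr p = 0\<close> is the intended convention.\<close>

definition mat_powr :: "complex^'n^'n \<Rightarrow> real \<Rightarrow> complex^'n^'n" where
  "mat_powr A p = herm_fun (\<lambda>x. x powr p) A"

text \<open>For positive semidefinite arguments the traces below are real, so taking \<open>Re\<close> only changes
  the type.\<close>

definition petz_renyi :: "real \<Rightarrow> complex^'n^'n \<Rightarrow> complex^'n^'n \<Rightarrow> ereal" where
  "petz_renyi \<alpha> \<rho> \<sigma> =
     (let t = Re (trace (mat_powr \<rho> \<alpha> ** mat_powr \<sigma> (1 - \<alpha>)))
      in if t = 0 then \<infinity> else ereal (1 / (\<alpha> - 1) * log 2 t))"

definition neg_log2 :: "real \<Rightarrow> ereal" where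
  "neg_log2 x = (if x = 0 then \<infinity> else ereal (- log 2 x))"

text \<open>For \<open>\<epsilon> \<ge> 0\<close> and density operators the set is nonempty (it contains the value at the identity)
  and bounded below by 0, so the real infimum is meaningful.\<close>

definition hypothesis_testing_entropy ::
    "real \<Rightarrow> complex^'n^'n \<Rightarrow> complex^'n^'n \<Rightarrow> ereal" where
  "hypothesis_testing_entropy \<epsilon> \<rho> \<sigma> =
     neg_log2 (Inf {Re (trace (P ** \<sigma>)) | P.
       loewner_le 0 P \<and> loewner_le P (mat 1) \<and> Re (trace (P ** \<rho>)) \<ge> 1 - \<epsilon>})"

definition binary_entropy :: "real \<Rightarrow> real" where
  "binary_entropy p = - p * log 2 p - (1 - p) * log 2 (1 - p)"

end

theory Submission
  imports Defs
begin

text \<open>The bound rests on the inequality of Audenaert et al.: for positive semidefinite \<open>A\<close>, \<open>B\<close> the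
  projection \<open>P\<close> onto the positive part of \<open>A - B\<close> satisfies
  \<open>Tr[(1 - P) A] + Tr[P B] \<le> Tr[A\<^sup>\<alpha> B\<^bsup>1-\<alpha>\<^esup>]\<close>; its proof, due to Ozawa, only uses operator monotonicity of
  \<open>x \<mapsto> x\<^sup>s\<close> for \<open>0 < s < 1\<close>. Applied to \<open>a \<rho>\<close> and \<open>b \<sigma>\<close> it bounds every weighted sum of the two error
  probabilities. The pairs of achievable errors form a convex set, so if \<open>\<beta>\<close> is the least type II
  error at type I error \<open>\<epsilon>\<close>, some line \<open>a x + b y = const\<close> separates this set from the quadrant below
  \<open>(\<epsilon>, \<beta>)\<close>, whence \<open>a \<epsilon> + b \<beta> \<le> a\<^sup>\<alpha> b\<^bsup>1-\<alpha>\<^esup> Tr[\<rho>\<^sup>\<alpha> \<sigma>\<^bsup>1-\<alpha>\<^esup>]\<close>. The weighted AM-GM inequality on the left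
  eliminates \<open>a\<close> and \<open>b\<close>, and its weights produce the entropy term \<open>h(\<alpha>)\<close>.\<close>

section \<open>Adjoints and the spectral theorem\<close>

lemma adjoint_mat_adjoint [simp]: "adjoint_mat (adjoint_mat A) = A"
  by (simp add: adjoint_mat_def vec_eq_iff)

lemma adjoint_mat_mult: "adjoint_mat (A ** B) = adjoint_mat B ** adjoint_mat A"
  by (simp add: adjoint_mat_def matrix_matrix_mult_def vec_eq_iff mult.commute)

lemma adjoint_mat_add: "adjoint_mat (A + B) = adjoint_mat A + adjoint_mat B"
  by (simp add: adjoint_mat_def vec_eq_iff)

lemma adjoint_mat_diff: "adjoint_mat (A - B) = adjoint_mat A - adjoint_mat B"
  by (simp add: adjoint_mat_def vec_eq_iff)

lemma adjoint_mat_scaleR: "adjoint_mat (r *\<^sub>R A) = r *\<^sub>R adjoint_mat A"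
  by (simp add: adjoint_mat_def vec_eq_iff)

lemma adjoint_real_diag [simp]: "adjoint_mat (real_diag d) = real_diag d"
  by (simp add: adjoint_mat_def real_diag_def vec_eq_iff)

lemma matrix_mult_add_rdistrib: "(A + B) ** C = A ** C + B ** (C :: 'a::comm_semiring_1^'n^'m)"
  by (simp add: matrix_matrix_mult_def vec_eq_iff distrib_right sum.distrib)

lemma matrix_mult_diff_rdistrib: "(A - B) ** C = A ** C - B ** (C :: 'a::comm_ring_1^'n^'m)"
  by (simp add: matrix_matrix_mult_def vec_eq_iff left_diff_distrib sum_subtractf)

lemma matrix_mult_diff_ldistrib: "C ** (A - B) = C ** A - C ** (B :: 'a::comm_ring_1^'n^'m)"
  by (simp add: matrix_matrix_mult_def vec_eq_iff right_diff_distrib sum_subtractf)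

lemma matrix_mult_scaleR_left: "(r *\<^sub>R A) ** B = r *\<^sub>R (A ** (B :: complex^'n^'m))"
  by (simp add: matrix_matrix_mult_def vec_eq_iff scaleR_sum_right)

lemma matrix_mult_scaleR_right: "A ** (r *\<^sub>R B) = r *\<^sub>R (A ** (B :: complex^'n^'m))"
  by (simp add: matrix_matrix_mult_def vec_eq_iff scaleR_sum_right)

lemma matrix_vector_mult_scaleR_left: "(r *\<^sub>R A) *v v = r *\<^sub>R (A *v (v :: complex^'n))"
  by (simp add: matrix_vector_mult_def vec_eq_iff scaleR_sum_right)

lemma matrix_vector_mult_scaleR_right: "A *v (r *\<^sub>R v) = r *\<^sub>R (A *v (v :: complex^'n))"
  by (simp add: matrix_vector_mult_def vec_eq_iff scaleR_sum_right)

lemma cinner_vec_mult: "cinner_vec v (A *v w) = cinner_vec (adjoint_mat A *v v) w"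
proof -
  have "cinner_vec v (A *v w) = (\<Sum>i\<in>UNIV. \<Sum>j\<in>UNIV. cnj (v$i) * A$i$j * w$j)"
    by (simp add: cinner_vec_def matrix_vector_mult_def sum_distrib_left mult.assoc)
  also have "\<dots> = (\<Sum>j\<in>UNIV. \<Sum>i\<in>UNIV. cnj (v$i) * A$i$j * w$j)"
    by (rule sum.swap)
  also have "\<dots> = cinner_vec (adjoint_mat A *v v) w"
    by (simp add: cinner_vec_def matrix_vector_mult_def adjoint_mat_def sum_distrib_right
        mult.commute[of "cnj _"])
  finally show ?thesis .
qed

lemma cinner_vec_add_right: "cinner_vec w (u + v) = cinner_vec w u + cinner_vec w v"
  by (simp add: cinner_vec_def algebra_simps sum.distrib)

lemma cinner_vec_diff_right: "cinner_vec w (u - v) = cinner_vec w u - cinner_vec w v"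
  by (simp add: cinner_vec_def algebra_simps sum_subtractf)

lemma cinner_vec_scaleR_right: "cinner_vec v (r *\<^sub>R w) = r *\<^sub>R cinner_vec v w"
  by (simp add: cinner_vec_def scaleR_sum_right)

lemma cinner_vec_smult_left: "cinner_vec (c *s v) w = cnj c * cinner_vec v w"
  by (simp add: cinner_vec_def sum_distrib_left mult.assoc)

lemma cinner_vec_commute: "cinner_vec v w = cnj (cinner_vec w v)"
  by (simp add: cinner_vec_def mult.commute)

lemma Re_cinner_vec: "Re (cinner_vec v w) = v \<bullet> w"
  by (simp add: cinner_vec_def inner_vec_def inner_complex_def)

lemma cinner_vec_self: "cinner_vec v v = complex_of_real ((norm v)\<^sup>2)"
proof -
  have "Im (cinner_vec v v) = 0"
    by (simp add: cinner_vec_def mult.commute)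
  then show ?thesis
    by (simp add: complex_eq_iff Re_cinner_vec power2_norm_eq_inner)
qed

section \<open>Orthonormal eigenvectors of a Hermitian matrix\<close>

text \<open>The conjugates of the \<open>u i\<close> form the rows of a square matrix whose
  \<open>j\<close>-th row is zero. It is therefore singular, and a normalised kernel vector does the
  job.\<close>

lemma exists_orthogonal_vec:
  fixes u :: "'n \<Rightarrow> complex^'n"
  assumes "j \<notin> I"
  obtains w where "norm w = 1" and "\<And>i. i \<in> I \<Longrightarrow> cinner_vec (u i) w = 0"
proof -
  define M :: "complex^'n^'n" where "M = (\<chi> i k. if i \<in> I then cnj (u i $ k) else 0)"
  have "\<not> (\<exists>B. B ** M = mat 1)"
  proof
    assume "\<exists>B. B ** M = mat 1"
    then obtain B where "B ** M = mat 1" ..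
    then have "M ** B = mat 1"
      by (rule matrix_left_right_inverse1)
    then have "(M ** B) $ j $ j = 1"
      by (simp add: mat_def)
    then show False
      using assms by (simp add: M_def matrix_matrix_mult_def)
  qed
  then obtain w where w: "M *v w = 0" "w \<noteq> 0"
    using matrix_left_invertible_ker by blast
  have "cinner_vec (u i) w = 0" if "i \<in> I" for i
  proof -
    have "(M *v w) $ i = cinner_vec (u i) w"
      using that by (simp add: M_def matrix_vector_mult_def cinner_vec_def)
    then show ?thesis using w by simp
  qed
  then show thesis
    using that[of "(1 / norm w) *\<^sub>R w"] w by (simp add: cinner_vec_scaleR_right)
qed

lemma continuous_on_matrix_vector_mult [continuous_intros]:
  "continuous_on S f \<Longrightarrow> continuous_on S (\<lambda>x. (A :: complex^'n^'m) *v f x)"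
  by (rule continuous_on_compose2[of UNIV "(*v) A"])
    (auto intro!: linear_continuous_on simp: linear_linear)

text \<open>Rayleigh's principle: the orthogonal complement of the \<open>u i\<close> is invariant
  under \<open>A\<close>, and a maximiser of the quadratic form on its unit sphere is an
  eigenvector.\<close>

lemma exists_eigenvector_orthogonal:
  fixes u :: "'n \<Rightarrow> complex^'n"
  assumes A: "hermitian A" and j: "j \<notin> I"
    and u: "\<And>i. i \<in> I \<Longrightarrow> A *v u i = complex_of_real (d i) *s u i"
  obtains w m where "norm w = 1" "\<And>i. i \<in> I \<Longrightarrow> cinner_vec (u i) w = 0"
    "A *v w = complex_of_real m *s w"
proof -
  define W where "W = {w. \<forall>i\<in>I. cinner_vec (u i) w = 0}"
  define q where "q w = w \<bullet> (A *v w)" for w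
  have adj: "cinner_vec v (A *v w) = cinner_vec (A *v v) w" for v w
    using A by (simp add: cinner_vec_mult hermitian_def)
  have W_add: "v + r *\<^sub>R w \<in> W" if "v \<in> W" "w \<in> W" for v w r
    using that by (simp add: W_def cinner_vec_add_right cinner_vec_scaleR_right)
  have W_A: "A *v w \<in> W" if "w \<in> W" for w
    using that u by (simp add: W_def adj cinner_vec_smult_left)
  have "closed W"
  proof -
    have "W = (\<Inter>i\<in>I. {w. cinner_vec (u i) w = 0})"
      by (auto simp: W_def)
    then show ?thesis
      unfolding cinner_vec_def by (auto intro!: closed_INT closed_Collect_eq continuous_intros)
  qed
  then have "compact (W \<inter> sphere 0 1)"
    by (intro closed_Int_compact) auto
  moreover have "W \<inter> sphere 0 1 \<noteq> {}"
  proof -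
    obtain v where "norm v = 1" "\<And>i. i \<in> I \<Longrightarrow> cinner_vec (u i) v = 0"
      using exists_orthogonal_vec[OF j] by metis
    then have "v \<in> W \<inter> sphere 0 1"
      by (simp add: W_def)
    then show ?thesis by blast
  qed
  moreover have "continuous_on (W \<inter> sphere 0 1) q"
    unfolding q_def by (intro continuous_intros)
  ultimately obtain w where "w \<in> W \<inter> sphere 0 1" and "\<forall>v\<in>W \<inter> sphere 0 1. q v \<le> q w"
    using continuous_attains_sup[of "W \<inter> sphere 0 1" q] by metis
  then have w: "w \<in> W" "norm w = 1"
    and max: "\<And>v. v \<in> W \<Longrightarrow> norm v = 1 \<Longrightarrow> q v \<le> q w"
    by auto
  \<comment> \<open>Both sides are homogeneous of degree two, so the bound extends from the unit
    sphere to all of \<open>W\<close>.\<close>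
  have max': "q v \<le> q w * (v \<bullet> v)" if "v \<in> W" for v
  proof (cases "v = 0")
    case True then show ?thesis by (simp add: q_def)
  next
    case False
    have "(1 / norm v) *\<^sub>R v \<in> W"
      using that by (simp add: W_def cinner_vec_scaleR_right)
    then have "q ((1 / norm v) *\<^sub>R v) \<le> q w"
      using False by (intro max) auto
    moreover have "q ((1 / norm v) *\<^sub>R v) = q v / (norm v)\<^sup>2"
      by (simp add: q_def matrix_vector_mult_scaleR_right power2_eq_square)
    ultimately show ?thesis
      using False by (simp add: pos_divide_le_eq flip: power2_norm_eq_inner)
  qed
  \<comment> \<open>The residual \<open>x\<close> vanishes iff \<open>w\<close> is an eigenvector
    for \<open>q w\<close>. It lies in \<open>W\<close>, so it is an admissible direction for
    perturbing \<open>w\<close>.\<close>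
  define x where "x = A *v w - q w *\<^sub>R w"
  have xW: "x \<in> W"
    using W_add[OF W_A[OF w(1)] w(1), of "- q w"] by (simp add: x_def)
  have ww: "w \<bullet> w = 1"
    using w by (simp add: power2_norm_eq_inner[symmetric])
  have sym: "w \<bullet> (A *v x) = x \<bullet> (A *v w)"
    using arg_cong[OF adj[of w x], of Re] by (simp add: Re_cinner_vec inner_commute)
  have xx: "x \<bullet> x = x \<bullet> (A *v w) - q w * (x \<bullet> w)"
    by (simp add: x_def inner_diff_right)
  \<comment> \<open>Maximality of \<open>w\<close> compared with its perturbation by
    \<open>t\<close> times \<open>x\<close>: the constant terms cancel and the linear ones combine
    to \<open>2 * t * (x \<bullet> x)\<close>.\<close>
  have small: "2 * t * (x \<bullet> x) \<le> t\<^sup>2 * (q w * (x \<bullet> x) - q x)" for t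
  proof -
    have "q (w + t *\<^sub>R x) \<le> q w * ((w + t *\<^sub>R x) \<bullet> (w + t *\<^sub>R x))"
      by (intro max' W_add w xW)
    moreover have "q (w + t *\<^sub>R x) = q w + 2 * t * (x \<bullet> (A *v w)) + t\<^sup>2 * q x"
      by (simp add: q_def matrix_vector_right_distrib matrix_vector_mult_scaleR_right
          inner_add_left inner_add_right sym algebra_simps power2_eq_square)
    moreover have "(w + t *\<^sub>R x) \<bullet> (w + t *\<^sub>R x) = 1 + 2 * t * (x \<bullet> w) + t\<^sup>2 * (x \<bullet> x)"
      by (simp add: inner_add_left inner_add_right ww inner_commute[of w x] algebra_simps
          power2_eq_square)
    ultimately have "q w + 2 * t * (x \<bullet> (A *v w)) + t\<^sup>2 * q x
        \<le> q w * (1 + 2 * t * (x \<bullet> w) + t\<^sup>2 * (x \<bullet> x))"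
      by metis
    then show ?thesis
      using arg_cong[OF xx, of "(*) (2 * t)"] by (simp add: algebra_simps)
  qed
  have "x \<bullet> x \<le> 0"
  proof (rule ccontr)
    assume "\<not> x \<bullet> x \<le> 0"
    then have pos: "x \<bullet> x > 0" by linarith
    \<comment> \<open>\<open>K\<close> bounds the coefficient of the quadratic term, and the added 1
      makes it positive. With this \<open>t\<close> the quadratic term is at most half the linear
      one.\<close>
    define K where "K = \<bar>q w * (x \<bullet> x) - q x\<bar> + 1"
    define t where "t = (x \<bullet> x) / K"
    have K: "K > 0" by (simp add: K_def)
    have t: "t > 0" using pos K by (simp add: t_def)
    have "2 * t * (x \<bullet> x) \<le> t\<^sup>2 * K"
      using small[of t] by (rule order_trans) (intro mult_left_mono, auto simp: K_def)
    also have "\<dots> = t * (x \<bullet> x)"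
      using K by (simp add: t_def power2_eq_square)
    finally show False using t pos by simp
  qed
  then have "x = 0"
    by (metis inner_eq_zero_iff inner_ge_zero order_antisym)
  then have "A *v w = q w *\<^sub>R w"
    by (simp add: x_def)
  then have "A *v w = complex_of_real (q w) *s w"
    by (simp add: vec_eq_iff) (simp add: scaleR_conv_of_real)
  with w show thesis
    using that by (auto simp: W_def)
qed

text \<open>Induction on the index set, adding one eigenvector at a time. The vectors are indexed by
  the matrix indices themselves, so a missing index means that there is room for another
  one.\<close>

lemma exists_orthonormal_eigenvectors:
  fixes A :: "complex^'n^'n" and I :: "'n set"
  assumes "hermitian A" and "finite I"
  shows "\<exists>u d. (\<forall>i\<in>I. \<forall>k\<in>I. cinner_vec (u i) (u k) = (if i = k then 1 else 0)) \<and>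
    (\<forall>i\<in>I. A *v u i = complex_of_real (d i) *s u i)"
  using \<open>finite I\<close>
proof (induction I)
  case empty
  show ?case by simp
next
  case (insert j I)
  then obtain u :: "'n \<Rightarrow> complex^'n" and d where
    orth: "\<And>i k. i \<in> I \<Longrightarrow> k \<in> I \<Longrightarrow> cinner_vec (u i) (u k) = (if i = k then 1 else 0)"
    and eig: "\<And>i. i \<in> I \<Longrightarrow> A *v u i = complex_of_real (d i) *s u i"
    by blast
  obtain w m where w: "norm w = 1" "\<And>i. i \<in> I \<Longrightarrow> cinner_vec (u i) w = 0"
    "A *v w = complex_of_real m *s w"
    by (rule exists_eigenvector_orthogonal[OF assms(1) insert.hyps(2), where u = u and d = d])
      (use eig in auto)
  have "cinner_vec w (u i) = 0" if "i \<in> I" for i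
    using w(2)[OF that] cinner_vec_commute[of w "u i"] by simp
  moreover have "cinner_vec w w = 1"
    using w(1) by (simp add: cinner_vec_self)
  ultimately show ?case
    using orth eig w insert.hyps(2)
    by (intro exI[of _ "u(j := w)"] exI[of _ "d(j := m)"]) auto
qed

theorem spectral_theorem:
  fixes A :: "complex^'n^'n"
  assumes "hermitian A"
  obtains U d where "spectral_decomp A U d"
proof -
  obtain u :: "'n \<Rightarrow> complex^'n" and d where
    orth: "\<And>i k. cinner_vec (u i) (u k) = (if i = k then 1 else 0)"
    and eig: "\<And>i. A *v u i = complex_of_real (d i) *s u i"
    using exists_orthonormal_eigenvectors[OF assms finite[of UNIV]]
    by auto
  define U :: "complex^'n^'n" where "U = (\<chi> i j. u j $ i)"
  have U: "adjoint_mat U ** U = mat 1"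
    using orth by (simp add: vec_eq_iff U_def adjoint_mat_def matrix_matrix_mult_def mat_def
        cinner_vec_def)
  then have U': "U ** adjoint_mat U = mat 1"
    by (rule matrix_left_right_inverse1)
  have "A ** U = U ** real_diag d"
    using eig unfolding vec_eq_iff real_diag_mult_right
    by (simp add: U_def matrix_matrix_mult_def matrix_vector_mult_def mult.commute)
  then have "A = U ** real_diag d ** adjoint_mat U"
    by (metis U' matrix_mul_assoc matrix_mul_rid)
  then show thesis
    using that U U' by (simp add: spectral_decomp_def unitary_def)
qed

section \<open>Positive semidefinite matrices and functional calculus\<close>

lemma hermitian_add: "hermitian A \<Longrightarrow> hermitian B \<Longrightarrow> hermitian (A + B)"
  by (simp add: hermitian_def adjoint_mat_add)

lemma hermitian_diff: "hermitian A \<Longrightarrow> hermitian B \<Longrightarrow> hermitian (A - B)"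
  by (simp add: hermitian_def adjoint_mat_diff)

lemma hermitian_scaleR: "hermitian A \<Longrightarrow> hermitian (r *\<^sub>R A)"
  by (simp add: hermitian_def adjoint_mat_scaleR)

lemma hermitian_conj_real_diag: "hermitian (U ** real_diag d ** adjoint_mat U)"
  by (simp add: hermitian_def adjoint_mat_mult matrix_mul_assoc)

lemma psd_add: "psd A \<Longrightarrow> psd B \<Longrightarrow> psd (A + B)"
  by (simp add: psd_def hermitian_add matrix_vector_mult_add_rdistrib cinner_vec_add_right)

lemma psd_scaleR: "0 \<le> r \<Longrightarrow> psd A \<Longrightarrow> psd (r *\<^sub>R A)"
  by (simp add: psd_def hermitian_scaleR matrix_vector_mult_scaleR_left cinner_vec_scaleR_right)

lemma psd_one: "psd (mat 1)"
proof -
  have "hermitian (mat 1)"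
    by (simp add: hermitian_def adjoint_mat_def mat_def vec_eq_iff)
  then show ?thesis
    by (simp add: psd_def cinner_vec_self)
qed

lemma psd_zero: "psd 0"
  using psd_scaleR[OF order_refl psd_one] by simp

lemma loewner_le_iff:
  assumes "hermitian A" "hermitian B"
  shows "loewner_le A B \<longleftrightarrow>
    (\<forall>v. Re (cinner_vec v (A *v v)) \<le> Re (cinner_vec v (B *v v)))"
  using assms by (simp add: loewner_le_def psd_def hermitian_diff
      matrix_vector_mult_diff_rdistrib cinner_vec_diff_right)

lemma real_diag_mult_vec: "(real_diag d *v v) $ i = complex_of_real (d i) * v $ i"
  unfolding matrix_vector_mult_def real_diag_def by (simp add: if_distrib if_distribR cong: if_cong)

lemma quadratic_form_conj_real_diag:
  "Re (cinner_vec v (U ** real_diag d ** adjoint_mat U *v v)) =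
    (\<Sum>i\<in>UNIV. d i * (cmod ((adjoint_mat U *v v) $ i))\<^sup>2)"
proof -
  have "cinner_vec v (U ** real_diag d ** adjoint_mat U *v v) =
      cinner_vec (adjoint_mat U *v v) (real_diag d *v (adjoint_mat U *v v))"
    by (simp add: cinner_vec_mult flip: matrix_vector_mul_assoc)
  also have "\<dots> = (\<Sum>i\<in>UNIV. complex_of_real (d i * (cmod ((adjoint_mat U *v v) $ i))\<^sup>2))"
    unfolding cinner_vec_def real_diag_mult_vec
    by (intro sum.cong refl) (simp add: complex_norm_square mult_ac flip: of_real_power)
  finally show ?thesis by simp
qed

lemma psd_conj_real_diag: "(\<And>i. 0 \<le> d i) \<Longrightarrow> psd (U ** real_diag d ** adjoint_mat U)"
  by (simp add: psd_def hermitian_conj_real_diag quadratic_form_conj_real_diag sum_nonneg)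

lemma cinner_vec_axis_mult: "cinner_vec (axis i 1) (A *v axis i 1) = A $ i $ i"
  by (simp add: cinner_vec_def matrix_vector_mult_def axis_def if_distrib if_distribR cong: if_cong)

lemma psd_diag_nonneg: "psd A \<Longrightarrow> 0 \<le> Re (A $ i $ i)"
  by (simp add: psd_def flip: cinner_vec_axis_mult)

lemma psd_conj: "psd A \<Longrightarrow> psd (adjoint_mat U ** A ** U)"
  by (simp add: psd_def hermitian_def adjoint_mat_mult matrix_mul_assoc cinner_vec_mult[of _ "adjoint_mat U"]
      flip: matrix_vector_mul_assoc)

lemma spectral_decomp_conj:
  assumes "spectral_decomp A U d"
  shows "adjoint_mat U ** A ** U = real_diag d"
proof -
  have U: "adjoint_mat U ** U = mat 1" and A: "A = U ** real_diag d ** adjoint_mat U"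
    using assms by (auto simp: spectral_decomp_def unitary_def)
  have "adjoint_mat U ** A ** U = (adjoint_mat U ** U) ** real_diag d ** (adjoint_mat U ** U)"
    unfolding A by (simp add: matrix_mul_assoc)
  then show ?thesis
    by (simp add: U)
qed

lemma spectral_decomp_eigenvalue_nonneg:
  assumes "psd A" "spectral_decomp A U d"
  shows "0 \<le> d i"
  using psd_diag_nonneg[OF psd_conj[OF assms(1), of U], of i]
  by (simp add: spectral_decomp_conj[OF assms(2)] real_diag_def)

lemma spectral_decomp_psd:
  assumes "psd A"
  obtains U d where "spectral_decomp A U d" "\<And>i. 0 \<le> d i"
  using assms spectral_theorem spectral_decomp_eigenvalue_nonneg unfolding psd_def by metis

section \<open>Traces of products of positive semidefinite matrices\<close>

text \<open>In an eigenbasis of \<open>A\<close> the trace is the sum of the eigenvalues of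
  \<open>A\<close> times the diagonal entries of the conjugated \<open>B\<close>, all
  nonnegative.\<close>

lemma trace_mult_nonneg:
  assumes "psd A" "psd B"
  shows "0 \<le> Re (trace (A ** B))"
proof -
  obtain U d where U: "spectral_decomp A U d" and d: "\<And>i. 0 \<le> d i"
    using spectral_decomp_psd[OF assms(1)] by metis
  have "trace (A ** B) = trace (U ** (real_diag d ** adjoint_mat U ** B))"
    using U by (simp add: spectral_decomp_def matrix_mul_assoc)
  also have "\<dots> = trace (real_diag d ** (adjoint_mat U ** B ** U))"
    by (subst trace_mul_sym) (simp add: matrix_mul_assoc)
  finally have "Re (trace (A ** B)) = (\<Sum>i\<in>UNIV. d i * Re ((adjoint_mat U ** B ** U) $ i $ i))"
    by (simp add: trace_def real_diag_mult_left)
  then show ?thesis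
    using d psd_diag_nonneg[OF psd_conj[OF assms(2)]]
    by (auto intro!: sum_nonneg mult_nonneg_nonneg)
qed

lemma trace_mult_mono_right:
  assumes "psd A" "loewner_le B C"
  shows "Re (trace (A ** B)) \<le> Re (trace (A ** C))"
  using trace_mult_nonneg[OF assms(1), of "C - B"] assms(2)
  by (simp add: loewner_le_def matrix_mult_diff_ldistrib trace_sub)

lemma trace_mult_mono_left:
  assumes "loewner_le A B" "psd C"
  shows "Re (trace (A ** C)) \<le> Re (trace (B ** C))"
  using trace_mult_mono_right[OF assms(2,1)] by (simp only: trace_mul_sym[of C])

section \<open>Real powers of positive semidefinite matrices\<close>

lemma mat_powr_eq:
  "spectral_decomp A U d \<Longrightarrow>
    mat_powr A p = U ** real_diag (\<lambda>i. d i powr p) ** adjoint_mat U"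
  unfolding mat_powr_def by (rule herm_fun_eq)

lemma psd_mat_powr:
  assumes "psd A"
  shows "psd (mat_powr A p)"
  using spectral_decomp_psd[OF assms] by (metis mat_powr_eq psd_conj_real_diag powr_ge_zero)

lemma conj_real_diag_mult:
  assumes "unitary U"
  shows "(U ** real_diag d ** adjoint_mat U) ** (U ** real_diag e ** adjoint_mat U) =
    U ** real_diag (\<lambda>i. d i * e i) ** adjoint_mat U"
proof -
  have "(U ** real_diag d ** adjoint_mat U) ** (U ** real_diag e ** adjoint_mat U) =
      U ** real_diag d ** (adjoint_mat U ** U) ** real_diag e ** adjoint_mat U"
    by (simp add: matrix_mul_assoc)
  also have "\<dots> = U ** (real_diag d ** real_diag e) ** adjoint_mat U"
    using assms by (simp add: unitary_def matrix_mul_assoc)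
  also have "real_diag d ** real_diag e = real_diag (\<lambda>i. d i * e i)"
    by (simp add: vec_eq_iff real_diag_mult_left) (simp add: real_diag_def)
  finally show ?thesis .
qed

lemma conj_real_diag_diff:
  "U ** real_diag d ** adjoint_mat U - U ** real_diag e ** adjoint_mat U =
    U ** real_diag (\<lambda>i. d i - e i) ** adjoint_mat U"
proof -
  have "real_diag (\<lambda>i. d i - e i) = real_diag d - real_diag e"
    by (simp add: vec_eq_iff real_diag_def)
  then show ?thesis
    by (simp add: matrix_mult_diff_ldistrib matrix_mult_diff_rdistrib)
qed

lemma conj_real_diag_scaleR:
  "r *\<^sub>R (U ** real_diag d ** adjoint_mat U) = U ** real_diag (\<lambda>i. r * d i) ** adjoint_mat U"
proof -
  have "real_diag (\<lambda>i. r * d i) = r *\<^sub>R real_diag d"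
    by (simp add: vec_eq_iff real_diag_def scaleR_conv_of_real[of _ "of_real _"])
  then show ?thesis
    by (simp add: matrix_mult_scaleR_left matrix_mult_scaleR_right)
qed

lemma conj_real_diag_one:
  fixes U :: "complex^'n^'n"
  assumes "unitary U"
  shows "U ** real_diag (\<lambda>i. 1) ** adjoint_mat U = mat 1"
proof -
  have "real_diag (\<lambda>i::'n. 1) = mat 1"
    by (simp add: vec_eq_iff real_diag_def mat_def)
  then show ?thesis
    using assms by (simp add: unitary_def)
qed

lemma mat_powr_mult_complement:
  assumes "psd A"
  shows "mat_powr A p ** mat_powr A (1 - p) = A"
proof -
  obtain U d where U: "spectral_decomp A U d" and d: "\<And>i. 0 \<le> d i"
    using spectral_decomp_psd[OF assms] by metis
  \<comment> \<open>This includes zero eigenvalues, since \<open>0 powr p = 0\<close> for every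
    \<open>p\<close>.\<close>
  have "d i powr p * d i powr (1 - p) = d i" for i
    using d[of i] by (simp flip: powr_add)
  then show ?thesis
    unfolding mat_powr_eq[OF U] using U by (simp add: spectral_decomp_def conj_real_diag_mult)
qed

lemma mat_powr_scaleR:
  assumes "psd A" "0 \<le> r"
  shows "mat_powr (r *\<^sub>R A) p = r powr p *\<^sub>R mat_powr A p"
proof -
  obtain U d where U: "spectral_decomp A U d" and d: "\<And>i. 0 \<le> d i"
    using spectral_decomp_psd[OF assms(1)] by metis
  have "spectral_decomp (r *\<^sub>R A) U (\<lambda>i. r * d i)"
    using U by (simp add: spectral_decomp_def conj_real_diag_scaleR)
  then show ?thesis
    using assms(2) d by (simp add: mat_powr_eq[OF U] mat_powr_eq powr_mult conj_real_diag_scaleR)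
qed

section \<open>The Loewner--Heinz inequality\<close>

text \<open>The kernel is at most \<open>t powr (s - 1)\<close> up to 1, integrable since
  \<open>s > 0\<close>, and at most \<open>t powr (s - 2)\<close> beyond 1, integrable since
  \<open>s < 1\<close>.\<close>

lemma integrable_powr_kernel:
  assumes "0 < s" "s < 1"
  shows "integrable lborel (\<lambda>t::real. indicator {0<..} t * (1 / (1 + t) * t powr (s - 1)))"
proof -
  define f :: "real \<Rightarrow> real" where
    "f t = indicator {0..1} t *\<^sub>R t powr (s - 1) + indicator {1..} t *\<^sub>R t powr (s - 2)" for t
  have "(\<lambda>t::real. t powr (s - 1)) absolutely_integrable_on {0..1}"
    using has_integral_powr_from_0[of "s - 1" 1] assms
    by (intro nonnegative_absolutely_integrable_1) auto
  moreover have "(\<lambda>t::real. t powr (s - 2)) absolutely_integrable_on {1..}"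
    using has_integral_powr_to_inf[of "s - 2" 1] assms
    by (intro nonnegative_absolutely_integrable_1) auto
  ultimately have "integrable lebesgue f"
    unfolding f_def set_integrable_def by (rule Bochner_Integration.integrable_add)
  \<comment> \<open>Borel measurability turns integrability for the Lebesgue measure into
    integrability for \<open>lborel\<close>.\<close>
  moreover have "f \<in> borel_measurable lborel"
    unfolding f_def by measurable
  ultimately have "integrable lborel f"
    by (simp add: integrable_completion)
  then show ?thesis
  proof (rule Bochner_Integration.integrable_bound)
    have "norm (indicator {0<..} t * (1 / (1 + t) * t powr (s - 1))) \<le> norm (f t)" for t :: real
    proof (cases "t > 0")
      case True
      have "1 / (1 + t) * t powr (s - 1) \<le> f t"
      proof (cases "t \<le> 1")
        case True
        have "1 / (1 + t) * t powr (s - 1) \<le> 1 * t powr (s - 1)"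
          using \<open>t > 0\<close> by (intro mult_right_mono) auto
        then show ?thesis
          using \<open>t > 0\<close> True by (auto simp: f_def indicator_def)
      next
        case False
        have "1 / (1 + t) * t powr (s - 1) \<le> 1 / t * t powr (s - 1)"
          using \<open>t > 0\<close> by (intro mult_right_mono divide_left_mono) auto
        also have "\<dots> = t powr (s - 2)"
          using \<open>t > 0\<close> powr_diff[of t "s - 1" 1] by simp
        finally show ?thesis
          using \<open>t > 0\<close> False by (simp add: f_def)
      qed
      moreover have "f t \<ge> 0"
        by (simp add: f_def)
      ultimately show ?thesis
        using \<open>t > 0\<close> by simp
    qed simp
    then show "AE t in lborel. norm (indicator {0<..} t * (1 / (1 + t) * t powr (s - 1)) :: real)
        \<le> norm (f t)"
      by simp
  qed measurable
qed

text \<open>Stieltjes representation of \<open>x powr s\<close>; its explicit constant \<open>\<pi> / sin (\<pi> * s)\<close> is not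
  required, only its sign.\<close>

lemma powr_integral_representation:
  assumes "0 < s" "s < 1"
  obtains C :: real where "C > 0"
    "\<And>x. 0 \<le> x \<Longrightarrow> has_bochner_integral lborel
      (\<lambda>t. indicator {0<..} t * (x / (x + t) * t powr (s - 1))) (C * x powr s)"
proof -
  define g :: "real \<Rightarrow> real \<Rightarrow> real" where
    "g x t = indicator {0<..} t * (x / (x + t) * t powr (s - 1))" for x t
  define C where "C = integral\<^sup>L lborel (g 1)"
  have int: "integrable lborel (g 1)"
    using integrable_powr_kernel[OF assms] by (simp add: g_def[abs_def])
  \<comment> \<open>On \<open>{1..2}\<close> the factors are at least \<open>1 / 3\<close> and
    \<open>1 / 2\<close>; this crude bound serves to show \<open>C > 0\<close>.\<close>
  have "indicator {1..2} t * (1 / 6) \<le> g 1 t" for t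
  proof (cases "t \<in> {1..2}")
    case True
    have "1 / 3 * (1 / 2) \<le> 1 / (1 + t) * t powr (s - 1)"
    proof (intro mult_mono)
      have "1 / 2 \<le> t powr (- 1)"
        using True by (simp add: powr_minus field_simps)
      also have "\<dots> \<le> t powr (s - 1)"
        using True assms by (intro powr_mono) auto
      finally show "1 / 2 \<le> t powr (s - 1)" .
    qed (use True in \<open>auto simp: field_simps\<close>)
    then show ?thesis
      using True by (simp add: g_def)
  qed (auto simp: g_def indicator_def)
  then have "integral\<^sup>L lborel (\<lambda>t::real. indicator {1..2} t * (1 / 6)) \<le> C"
    unfolding C_def by (intro integral_mono int) auto
  then have C: "C > 0"
    by simp
  have "has_bochner_integral lborel (g x) (C * x powr s)" if "x \<ge> 0" for x
  proof (cases "x = 0")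
    case True
    then show ?thesis
      by (simp add: g_def[abs_def] has_bochner_integral_zero)
  next
    case False
    with that have x: "x > 0" by simp
    \<comment> \<open>Scaling the variable by \<open>x\<close> reduces the integral to the case
      \<open>x = 1\<close>; the Jacobian \<open>x\<close> turns the factor
      \<open>x powr (s - 1)\<close> into \<open>x powr s\<close>.\<close>
    have "g x (x * t) = x powr (s - 1) * g 1 t" for t
    proof (cases "t > 0")
      case True
      have "x / (x + x * t) = x * 1 / (x * (1 + t))"
        by (simp add: distrib_left)
      also have "\<dots> = 1 / (1 + t)"
        using x by (subst mult_divide_mult_cancel_left) auto
      finally show ?thesis
        using True x by (simp add: g_def powr_mult)
    next
      case False
      then show ?thesis using x by (simp add: g_def zero_less_mult_iff)
    qed
    moreover have "has_bochner_integral lborel (\<lambda>t. x powr (s - 1) * g 1 t) (x powr (s - 1) * C)"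
      unfolding C_def by (intro has_bochner_integral_mult_right has_bochner_integral_integrable int)
    moreover have "x powr (s - 1) * C = (C * x powr s) /\<^sub>R \<bar>x\<bar>"
      using x by (simp add: powr_diff field_simps)
    ultimately show ?thesis
      using x by (subst lborel_has_bochner_integral_real_affine_iff[of x _ _ 0]) auto
  qed
  with C show thesis
    using that by (simp add: g_def[abs_def])
qed

section \<open>Resolvents and operator monotonicity of powers\<close>

lemma unitary_cinner_vec:
  assumes "unitary U"
  shows "cinner_vec (adjoint_mat U *v v) (adjoint_mat U *v w) = cinner_vec v w"
  using assms by (simp add: cinner_vec_mult matrix_vector_mul_assoc unitary_def)

lemma Re_cinner_vec_spectral:
  assumes "spectral_decomp A U a"
  shows "Re (cinner_vec v (A *v v)) = (\<Sum>i\<in>UNIV. a i * (cmod ((adjoint_mat U *v v) $ i))\<^sup>2)"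
proof -
  have "A = U ** real_diag a ** adjoint_mat U"
    using assms by (simp add: spectral_decomp_def)
  then show ?thesis
    by (simp only: quadratic_form_conj_real_diag)
qed

lemma unitary_norm_sq:
  assumes "unitary U"
  shows "(norm v)\<^sup>2 = (\<Sum>i\<in>UNIV. (cmod ((adjoint_mat U *v v) $ i))\<^sup>2)"
proof -
  have "spectral_decomp (mat 1) U (\<lambda>i. 1)"
    using assms by (simp add: spectral_decomp_def conj_real_diag_one)
  from Re_cinner_vec_spectral[OF this, of v] show ?thesis
    by (simp add: cinner_vec_self)
qed

text \<open>Bound the real part by the modulus and complete the square. This is the variational
  formula for a single eigenvalue \<open>c\<close>, with equality at
  \<open>z = x / c\<close>.\<close>

lemma two_Re_mult_le:
  fixes c :: real
  assumes "c > 0"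
  shows "2 * Re (cnj x * z) - c * (cmod z)\<^sup>2 \<le> (cmod x)\<^sup>2 / c"
proof -
  have "Re (cnj x * z) \<le> cmod x * cmod z"
    using complex_Re_le_cmod[of "cnj x * z"] by (simp add: norm_mult)
  moreover have "0 \<le> (cmod x - c * cmod z)\<^sup>2 / c"
    using assms by simp
  moreover have "(cmod x - c * cmod z)\<^sup>2 / c
      = (cmod x)\<^sup>2 / c - 2 * (cmod x * cmod z) + c * (cmod z)\<^sup>2"
    using assms by (simp add: power2_eq_square field_simps)
  ultimately show ?thesis
    by linarith
qed

text \<open>Antitonicity of the resolvent, from the variational formula
  \<open>\<langle>v, M\<inverse> v\<rangle> = max\<^sub>w (2 Re \<langle>v, w\<rangle> - \<langle>w, M w\<rangle>)\<close> for positive definite \<open>M\<close>.\<close>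

lemma resolvent_antimono:
  assumes A: "spectral_decomp A U a" "\<And>i. 0 \<le> a i"
    and B: "spectral_decomp B V b" "\<And>i. 0 \<le> b i"
    and le: "\<And>v. Re (cinner_vec v (A *v v)) \<le> Re (cinner_vec v (B *v v))" and t: "t > 0"
  shows "(\<Sum>i\<in>UNIV. (cmod ((adjoint_mat V *v v) $ i))\<^sup>2 / (b i + t))
    \<le> (\<Sum>i\<in>UNIV. (cmod ((adjoint_mat U *v v) $ i))\<^sup>2 / (a i + t))"
proof -
  have U: "unitary U" and V: "unitary V"
    using A B by (simp_all add: spectral_decomp_def)
  \<comment> \<open>\<open>w\<close> is the inverse of \<open>B + t\<close> applied to
    \<open>v\<close>, the maximiser in the variational formula for \<open>B + t\<close>.\<close>
  define w where "w = V *v (\<chi> i. (adjoint_mat V *v v) $ i / complex_of_real (b i + t))"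
  have w: "(adjoint_mat V *v w) $ i = (adjoint_mat V *v v) $ i / complex_of_real (b i + t)" for i
    using V by (simp add: w_def matrix_vector_mul_assoc unitary_def)
  \<comment> \<open>In an eigenbasis of \<open>M\<close> the variational functional of
    \<open>M + t\<close> decouples into one term per eigenvalue.\<close>
  have split: "2 * Re (cinner_vec v w) - Re (cinner_vec w (M *v w)) - t * (norm w)\<^sup>2 =
      (\<Sum>i\<in>UNIV. 2 * Re (cnj ((adjoint_mat Z *v v) $ i) * (adjoint_mat Z *v w) $ i)
        - (m i + t) * (cmod ((adjoint_mat Z *v w) $ i))\<^sup>2)" if "spectral_decomp M Z m" for M Z m
  proof -
    have Z: "unitary Z"
      using that by (simp add: spectral_decomp_def)
    have "Re (cinner_vec v w) =
        (\<Sum>i\<in>UNIV. Re (cnj ((adjoint_mat Z *v v) $ i) * (adjoint_mat Z *v w) $ i))"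
      by (subst unitary_cinner_vec[OF Z, symmetric]) (simp only: cinner_vec_def Re_sum)
    then show ?thesis
      by (simp only: Re_cinner_vec_spectral[OF that] unitary_norm_sq[OF Z, of w] sum_distrib_left
          sum_subtractf distrib_right sum.distrib diff_diff_eq)
  qed
  \<comment> \<open>The choice of \<open>w\<close> attains the maximum for \<open>B\<close>; for
    \<open>A\<close> the same vector is merely a competitor.\<close>
  have "(\<Sum>i\<in>UNIV. (cmod ((adjoint_mat V *v v) $ i))\<^sup>2 / (b i + t)) =
      2 * Re (cinner_vec v w) - Re (cinner_vec w (B *v w)) - t * (norm w)\<^sup>2"
    unfolding split[OF B(1)]
  proof (rule sum.cong[OF refl])
    fix i
    define y c where "y = (adjoint_mat V *v v) $ i" and "c = b i + t"
    have c: "c > 0"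
      using B(2)[of i] t by (simp add: c_def)
    have "cnj y * (y / complex_of_real c) = complex_of_real ((cmod y)\<^sup>2 / c)"
      by (simp add: complex_norm_square mult.commute del: of_real_power)
    then have "Re (cnj y * (y / complex_of_real c)) = (cmod y)\<^sup>2 / c"
      by (simp only: Re_complex_of_real)
    moreover have "c * (cmod (y / complex_of_real c))\<^sup>2 = (cmod y)\<^sup>2 / c"
      using c by (simp add: norm_divide power2_eq_square)
    ultimately show "(cmod ((adjoint_mat V *v v) $ i))\<^sup>2 / (b i + t) =
        2 * Re (cnj ((adjoint_mat V *v v) $ i) * (adjoint_mat V *v w) $ i)
          - (b i + t) * (cmod ((adjoint_mat V *v w) $ i))\<^sup>2"
      unfolding w y_def[symmetric] c_def[symmetric] by linarith
  qed
  also have "\<dots> \<le> 2 * Re (cinner_vec v w) - Re (cinner_vec w (A *v w)) - t * (norm w)\<^sup>2"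
    using le[of w] by simp
  also have "\<dots> \<le> (\<Sum>i\<in>UNIV. (cmod ((adjoint_mat U *v v) $ i))\<^sup>2 / (a i + t))"
    unfolding split[OF A(1)] using A(2) t by (intro sum_mono two_Re_mult_le) (simp add: add_nonneg_pos)
  finally show ?thesis .
qed

text \<open>Up to a positive constant, \<open>x powr s\<close> is a positive mixture of the
  functions \<open>x / (x + t) = 1 - t / (x + t)\<close>, which are operator monotone because
  resolvents are antitone. Fixing \<open>v\<close> and integrating quadratic forms keeps all
  integrals scalar.\<close>

theorem loewner_heinz:
  fixes A B :: "complex^'n^'n"
  assumes "psd A" "psd B" "loewner_le A B" "0 < s" "s < 1"
  shows "loewner_le (mat_powr A s) (mat_powr B s)"
proof -
  obtain U a where A: "spectral_decomp A U a" "\<And>i. 0 \<le> a i"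
    using spectral_decomp_psd[OF assms(1)] by metis
  obtain V b where B: "spectral_decomp B V b" "\<And>i. 0 \<le> b i"
    using spectral_decomp_psd[OF assms(2)] by metis
  have le: "Re (cinner_vec v (A *v v)) \<le> Re (cinner_vec v (B *v v))" for v
    using assms by (simp add: loewner_le_iff psd_def)
  obtain C :: real where C: "C > 0" and rep: "\<And>x. 0 \<le> x \<Longrightarrow> has_bochner_integral lborel
      (\<lambda>t. indicator {0<..} t * (x / (x + t) * t powr (s - 1))) (C * x powr s)"
    using powr_integral_representation[OF assms(4,5)] by metis
  have "Re (cinner_vec v (mat_powr A s *v v)) \<le> Re (cinner_vec v (mat_powr B s *v v))" for v
  proof -
    define x y where "x i = (cmod ((adjoint_mat U *v v) $ i))\<^sup>2"
      and "y i = (cmod ((adjoint_mat V *v v) $ i))\<^sup>2" for i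
    \<comment> \<open>For eigenvalues \<open>e\<close> and squared coordinates \<open>z\<close> of
      \<open>v\<close> in the eigenbasis, \<open>F e z\<close> is the integrand representing
      \<open>C\<close> times the quadratic form of the power at \<open>v\<close>.\<close>
    define F where "F e z t = (\<Sum>i\<in>UNIV.
        indicator {0<..} t * (e i / (e i + t) * t powr (s - 1)) * z i)"
      for e z :: "'n \<Rightarrow> real" and t
    have F: "has_bochner_integral lborel (F e z) (\<Sum>i\<in>UNIV. C * e i powr s * z i)"
      if "\<And>i. 0 \<le> e i" for e z
      unfolding F_def by (intro has_bochner_integral_sum has_bochner_integral_mult_left rep that)
    \<comment> \<open>Both sums equal the squared norm of \<open>v\<close>, so only the resolvent
      terms need comparing.\<close>
    have "(\<Sum>i\<in>UNIV. x i) = (\<Sum>i\<in>UNIV. y i)"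
      using A(1) B(1) unfolding x_def y_def spectral_decomp_def by (metis unitary_norm_sq)
    have "F a x t \<le> F b y t" for t
    proof (cases "t > 0")
      case True
      have resolvent: "F e z t = ((\<Sum>i\<in>UNIV. z i) - t * (\<Sum>i\<in>UNIV. z i / (e i + t))) * t powr (s - 1)"
        if "\<And>i. 0 \<le> e i" for e z
      proof -
        have "e i / (e i + t) * z i = z i - t * (z i / (e i + t))" for i
          using that[of i] True by (simp add: field_simps)
        moreover have "F e z t = (\<Sum>i\<in>UNIV. e i / (e i + t) * z i * t powr (s - 1))"
          using True unfolding F_def by (intro sum.cong refl) simp
        ultimately show ?thesis
          by (simp only: sum_distrib_right[symmetric] sum_subtractf sum_distrib_left)
      qed
      have "(\<Sum>i\<in>UNIV. y i / (b i + t)) \<le> (\<Sum>i\<in>UNIV. x i / (a i + t))"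
        unfolding x_def y_def by (rule resolvent_antimono[OF A B le True])
      then show ?thesis
        unfolding resolvent[OF A(2)] resolvent[OF B(2)] \<open>(\<Sum>i\<in>UNIV. x i) = (\<Sum>i\<in>UNIV. y i)\<close>
        using True by (intro mult_right_mono diff_left_mono mult_left_mono) auto
    qed (simp add: F_def)
    then have "integral\<^sup>L lborel (F a x) \<le> integral\<^sup>L lborel (F b y)"
      using F[OF A(2)] F[OF B(2)] by (intro integral_mono) (auto simp: has_bochner_integral_iff)
    then have "(\<Sum>i\<in>UNIV. C * a i powr s * x i) \<le> (\<Sum>i\<in>UNIV. C * b i powr s * y i)"
      using F[OF A(2), where z = x] F[OF B(2), where z = y] by (simp add: has_bochner_integral_iff)
    then have "C * (\<Sum>i\<in>UNIV. a i powr s * x i) \<le> C * (\<Sum>i\<in>UNIV. b i powr s * y i)"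
      by (simp add: sum_distrib_left mult.assoc)
    then show ?thesis
      using C unfolding mat_powr_eq[OF A(1)] mat_powr_eq[OF B(1)] quadratic_form_conj_real_diag
      by (simp add: x_def y_def)
  qed
  then show ?thesis
    using psd_mat_powr[OF assms(1)] psd_mat_powr[OF assms(2)] by (simp add: loewner_le_iff psd_def)
qed

section \<open>Quantum hypothesis testing\<close>

text \<open>The optimal test is the projection onto the positive part of \<open>A - B\<close>. Both \<open>A\<close> and \<open>B\<close> are
  dominated by \<open>C = B + (A - B)\<^sub>+\<close>, which is what the Loewner--Heinz inequality is applied to.\<close>

theorem trace_powr_ge_test_error:
  fixes A B :: "complex^'n^'n"
  assumes A: "psd A" and B: "psd B" and s: "0 < s" "s < 1"
  obtains P where "loewner_le 0 P" "loewner_le P (mat 1)"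
    "Re (trace A) - Re (trace (P ** A)) + Re (trace (P ** B))
      \<le> Re (trace (mat_powr A s ** mat_powr B (1 - s)))"
proof -
  have "hermitian (A - B)"
    using A B by (simp add: psd_def hermitian_diff)
  then obtain U d where dec: "spectral_decomp (A - B) U d"
    using spectral_theorem by blast
  then have U: "unitary U" and AB: "A - B = U ** real_diag d ** adjoint_mat U"
    by (simp_all add: spectral_decomp_def)
  define P where "P = U ** real_diag (\<lambda>i. if 0 < d i then 1 else 0) ** adjoint_mat U"
  define Q where "Q = U ** real_diag (\<lambda>i. max (d i) 0) ** adjoint_mat U"
  define C where "C = B + Q"
  define tr where "tr M = Re (trace M)" for M :: "complex^'n^'n"
  have P0: "loewner_le 0 P"
    by (simp add: loewner_le_def P_def psd_conj_real_diag)
  have P1: "loewner_le P (mat 1)"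
    unfolding loewner_le_def P_def conj_real_diag_one[OF U, symmetric] conj_real_diag_diff
    by (rule psd_conj_real_diag) simp
  have PQ: "P ** (A - B) = Q"
    unfolding AB P_def Q_def conj_real_diag_mult[OF U]
    by (rule arg_cong[where f = "\<lambda>d. U ** real_diag d ** adjoint_mat U"]) auto
  have Q: "psd Q"
    unfolding Q_def by (rule psd_conj_real_diag) simp
  have C: "psd C"
    unfolding C_def by (rule psd_add[OF B Q])
  have BC: "loewner_le B C"
    using Q by (simp add: loewner_le_def C_def)
  \<comment> \<open>The difference \<open>Q - (A - B)\<close> is the negative part of
    \<open>A - B\<close>.\<close>
  have "C - A = Q - (A - B)"
    by (simp add: C_def)
  also have "psd \<dots>"
    unfolding AB Q_def conj_real_diag_diff by (rule psd_conj_real_diag) simp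
  finally have AC: "loewner_le A C"
    by (simp add: loewner_le_def)
  have s': "0 < 1 - s" "1 - s < 1"
    using s by simp_all
  have mono: "loewner_le (mat_powr A (1 - s)) (mat_powr C (1 - s))"
    "loewner_le (mat_powr B (1 - s)) (mat_powr C (1 - s))"
    "loewner_le (mat_powr A s) (mat_powr C s)" "loewner_le (mat_powr B s) (mat_powr C s)"
    using loewner_heinz A B C AC BC s s' by blast+
  \<comment> \<open>The decisive step: against this positive semidefinite difference,
    \<open>mat_powr A s\<close> may be enlarged to \<open>mat_powr C s\<close>. The mixed traces
    with one power of \<open>C\<close> are then bounded below by \<open>tr A\<close> and
    \<open>tr B\<close>.\<close>
  have "psd (mat_powr C (1 - s) - mat_powr B (1 - s))"
    using mono(2) by (simp add: loewner_le_def)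
  then have "tr (mat_powr A s ** (mat_powr C (1 - s) - mat_powr B (1 - s)))
      \<le> tr (mat_powr C s ** (mat_powr C (1 - s) - mat_powr B (1 - s)))"
    unfolding tr_def by (rule trace_mult_mono_left[OF mono(3)])
  moreover have "tr A \<le> tr (mat_powr A s ** mat_powr C (1 - s))"
    using trace_mult_mono_right[OF psd_mat_powr[OF A] mono(1), of s]
    by (simp add: tr_def mat_powr_mult_complement[OF A])
  moreover have "tr B \<le> tr (mat_powr C s ** mat_powr B (1 - s))"
    using trace_mult_mono_left[OF mono(4) psd_mat_powr[OF B], of "1 - s"]
    by (simp add: tr_def mat_powr_mult_complement[OF B])
  \<comment> \<open>Here \<open>Q = P ** (A - B)\<close> brings the test \<open>P\<close> into the
    estimate.\<close>
  moreover have "tr C = tr B + tr (P ** A) - tr (P ** B)"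
    unfolding C_def PQ[symmetric] by (simp add: tr_def trace_add trace_sub matrix_mult_diff_ldistrib)
  ultimately have "tr A - tr (P ** A) + tr (P ** B) \<le> tr (mat_powr A s ** mat_powr B (1 - s))"
    by (simp add: tr_def matrix_mult_diff_ldistrib trace_sub mat_powr_mult_complement[OF C])
  then show thesis
    using that[OF P0 P1] by (simp add: tr_def)
qed

section \<open>Trade-off between the two error probabilities\<close>

lemma trace_scaleR: "trace (r *\<^sub>R A) = r *\<^sub>R trace (A :: complex^'n^'n)"
  by (simp add: trace_def scaleR_sum_right)

text \<open>The test for the operators scaled by \<open>a\<close> and \<open>b\<close> is taken;
  homogeneity of the powers pulls the weights out of the trace.\<close>

lemma weighted_test_error_le:
  fixes \<rho> \<sigma> :: "complex^'n^'n"
  assumes "psd \<rho>" "psd \<sigma>" "0 < \<alpha>" "\<alpha> < 1" "0 \<le> a" "0 \<le> b"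
  obtains P where "loewner_le 0 P" "loewner_le P (mat 1)"
    "a * (Re (trace \<rho>) - Re (trace (P ** \<rho>))) + b * Re (trace (P ** \<sigma>))
      \<le> a powr \<alpha> * b powr (1 - \<alpha>) * Re (trace (mat_powr \<rho> \<alpha> ** mat_powr \<sigma> (1 - \<alpha>)))"
proof -
  obtain P where "loewner_le 0 P" "loewner_le P (mat 1)"
    and "Re (trace (a *\<^sub>R \<rho>)) - Re (trace (P ** (a *\<^sub>R \<rho>))) + Re (trace (P ** (b *\<^sub>R \<sigma>)))
      \<le> Re (trace (mat_powr (a *\<^sub>R \<rho>) \<alpha> ** mat_powr (b *\<^sub>R \<sigma>) (1 - \<alpha>)))"
    using trace_powr_ge_test_error[of "a *\<^sub>R \<rho>" "b *\<^sub>R \<sigma>" \<alpha>] psd_scaleR assms by metis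
  then show thesis
    using assms
    by (intro that[of P]) (auto simp: mat_powr_scaleR matrix_mult_scaleR_left matrix_mult_scaleR_right
        trace_scaleR right_diff_distrib mult_ac)
qed

lemma convex_effects: "convex {P :: complex^'n^'n. loewner_le 0 P \<and> loewner_le P (mat 1)}"
proof (rule convexI)
  fix P Q :: "complex^'n^'n" and u v :: real
  assume P: "P \<in> {P. loewner_le 0 P \<and> loewner_le P (mat 1)}"
    and Q: "Q \<in> {P. loewner_le 0 P \<and> loewner_le P (mat 1)}"
    and uv: "0 \<le> u" "0 \<le> v" "u + v = 1"
  have "mat 1 - (u *\<^sub>R P + v *\<^sub>R Q) = (u + v) *\<^sub>R mat 1 - (u *\<^sub>R P + v *\<^sub>R Q)"
    using uv by simp
  also have "\<dots> = u *\<^sub>R (mat 1 - P) + v *\<^sub>R (mat 1 - Q)"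
    by (simp only: algebra_simps)
  finally show "u *\<^sub>R P + v *\<^sub>R Q \<in> {P. loewner_le 0 P \<and> loewner_le P (mat 1)}"
    using P Q uv by (simp add: loewner_le_def psd_add psd_scaleR)
qed

text \<open>If every test of type I error at most \<open>\<epsilon>\<close> has type II error at least \<open>\<beta>\<close>, then a
  hyperplane separates the convex set of achievable error pairs from the quadrant below \<open>(\<epsilon>, \<beta>)\<close>.\<close>

lemma error_tradeoff_hyperplane:
  fixes \<rho> \<sigma> :: "complex^'n^'n"
  assumes le: "\<And>P. loewner_le 0 P \<Longrightarrow> loewner_le P (mat 1) \<Longrightarrow> 1 - \<epsilon> \<le> Re (trace (P ** \<rho>))
    \<Longrightarrow> \<beta> \<le> Re (trace (P ** \<sigma>))"
  obtains a b :: real where "0 \<le> a" "0 \<le> b" "a \<noteq> 0 \<or> b \<noteq> 0"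
    "\<And>P. loewner_le 0 P \<Longrightarrow> loewner_le P (mat 1) \<Longrightarrow>
      a * \<epsilon> + b * \<beta> \<le> a * (1 - Re (trace (P ** \<rho>))) + b * Re (trace (P ** \<sigma>))"
proof -
  define E where "E = {P :: complex^'n^'n. loewner_le 0 P \<and> loewner_le P (mat 1)}"
  define f where "f P = (1 - Re (trace (P ** \<rho>)), Re (trace (P ** \<sigma>)))" for P
  have "convex (f ` E)"
  proof (rule convexI)
    fix x y :: "real \<times> real" and u v :: real
    assume x: "x \<in> f ` E" and y: "y \<in> f ` E" and uv: "0 \<le> u" "0 \<le> v" "u + v = 1"
    then obtain P Q where PQ: "P \<in> E" "Q \<in> E" and xy: "x = f P" "y = f Q"
      by blast
    have "u *\<^sub>R P + v *\<^sub>R Q \<in> E"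
      using convexD[OF convex_effects] PQ uv unfolding E_def by blast
    moreover have "f (u *\<^sub>R P + v *\<^sub>R Q) = u *\<^sub>R x + v *\<^sub>R y"
      using uv by (simp add: f_def xy matrix_mult_add_rdistrib matrix_mult_scaleR_left trace_add trace_scaleR)
        (simp add: algebra_simps)
    ultimately show "u *\<^sub>R x + v *\<^sub>R y \<in> f ` E"
      by (metis image_eqI)
  qed
  moreover have "convex ({..\<epsilon>} \<times> {..<\<beta>})"
    by (simp add: convex_Times)
  moreover have "mat 1 \<in> E"
    by (simp add: E_def loewner_le_def psd_one psd_zero)
  then have "f ` E \<noteq> {}"
    by blast
  moreover have "{..\<epsilon>} \<times> {..<\<beta>} \<noteq> {}"
    by auto
  \<comment> \<open>The quadrant contains its edge at \<open>\<epsilon>\<close> but not at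
    \<open>\<beta>\<close>, so a common point would be a feasible test with type II error strictly
    below \<open>\<beta>\<close>.\<close>
  moreover have "({..\<epsilon>} \<times> {..<\<beta>}) \<inter> f ` E = {}"
    using le by (force simp: f_def E_def)
  ultimately obtain n c where n: "n \<noteq> 0" "\<And>x. x \<in> {..\<epsilon>} \<times> {..<\<beta>} \<Longrightarrow> n \<bullet> x \<le> c"
    "\<And>x. x \<in> f ` E \<Longrightarrow> c \<le> n \<bullet> x"
    using separating_hyperplane_sets[of "{..\<epsilon>} \<times> {..<\<beta>}" "f ` E"] by metis
  obtain a b where ab: "n = (a, b)"
    by (cases n)
  have quadrant: "a * x + b * y \<le> c" if "x \<le> \<epsilon>" "y < \<beta>" for x y
    using n(2)[of "(x, y)"] that by (simp add: ab)
  \<comment> \<open>The quadrant is unbounded to the left, where a negative \<open>a\<close> would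
    push the functional above \<open>c\<close>. The shift \<open>k / a\<close> raises it by
    \<open>k\<close>, more than the slack \<open>e\<close>. The argument for \<open>b\<close> is the
    same, downwards.\<close>
  have a: "a \<ge> 0"
  proof (rule ccontr)
    assume "\<not> a \<ge> 0"
    then have "a < 0" by simp
    define e where "e = c - a * \<epsilon> - b * (\<beta> - 1)"
    define k where "k = \<bar>e\<bar> + 1"
    have "a * (\<epsilon> + k / a) + b * (\<beta> - 1) \<le> c"
      using \<open>a < 0\<close> by (intro quadrant) (auto simp: k_def divide_le_0_iff)
    moreover have "a * (\<epsilon> + k / a) = a * \<epsilon> + k"
      using \<open>a < 0\<close> by (simp add: distrib_left)
    moreover have "k > e"
      by (simp add: k_def)
    ultimately show False
      unfolding e_def by linarith
  qed
  have b: "b \<ge> 0"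
  proof (rule ccontr)
    assume "\<not> b \<ge> 0"
    then have "b < 0" by simp
    define e where "e = c - a * \<epsilon> - b * \<beta>"
    define k where "k = \<bar>e\<bar> + 1"
    have "a * \<epsilon> + b * (\<beta> + k / b) \<le> c"
      using \<open>b < 0\<close> by (intro quadrant) (auto simp: k_def divide_less_0_iff)
    moreover have "b * (\<beta> + k / b) = b * \<beta> + k"
      using \<open>b < 0\<close> by (simp add: distrib_left)
    moreover have "k > e"
      by (simp add: k_def)
    ultimately show False
      unfolding e_def by linarith
  qed
  \<comment> \<open>The corner lies only in the closure of the quadrant, so for \<open>b > 0\<close>
    the bound is reached by letting \<open>y\<close> tend to \<open>\<beta>\<close> from
    below.\<close>
  have corner: "a * \<epsilon> + b * \<beta> \<le> c"
  proof (cases "b = 0")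
    case True
    then show ?thesis using quadrant[of \<epsilon> "\<beta> - 1"] by simp
  next
    case False
    with b have "b > 0" by simp
    have "\<beta> \<le> (c - a * \<epsilon>) / b"
    proof (rule dense_le)
      fix y assume "y < \<beta>"
      then show "y \<le> (c - a * \<epsilon>) / b"
        using quadrant[of \<epsilon> y] \<open>b > 0\<close> by (simp add: pos_le_divide_eq mult.commute)
    qed
    then show ?thesis
      using \<open>b > 0\<close> by (simp add: pos_le_divide_eq mult.commute)
  qed
  show thesis
  proof (rule that[OF a b])
    show "a \<noteq> 0 \<or> b \<noteq> 0"
      using n(1) by (simp add: ab zero_prod_def)
    fix P :: "complex^'n^'n"
    assume "loewner_le 0 P" "loewner_le P (mat 1)"
    then have "c \<le> n \<bullet> f P"
      by (intro n(3)) (simp add: E_def)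
    with corner show "a * \<epsilon> + b * \<beta> \<le> a * (1 - Re (trace (P ** \<rho>))) + b * Re (trace (P ** \<sigma>))"
      by (simp add: ab f_def)
  qed
qed

text \<open>The separating inequality and the bound on weighted errors are applied to the same test,
  which eliminates the test; AM-GM then eliminates the weights.\<close>

lemma type_two_error_bound:
  fixes \<rho> \<sigma> :: "complex^'n^'n"
  assumes \<rho>: "density_op \<rho>" and \<sigma>: "psd \<sigma>" and \<alpha>: "0 < \<alpha>" "\<alpha> < 1" and \<epsilon>: "0 < \<epsilon>" and \<beta>: "0 < \<beta>"
    and le: "\<And>P. loewner_le 0 P \<Longrightarrow> loewner_le P (mat 1) \<Longrightarrow> 1 - \<epsilon> \<le> Re (trace (P ** \<rho>))
      \<Longrightarrow> \<beta> \<le> Re (trace (P ** \<sigma>))"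
  shows "(\<epsilon> / \<alpha>) powr \<alpha> * (\<beta> / (1 - \<alpha>)) powr (1 - \<alpha>)
    \<le> Re (trace (mat_powr \<rho> \<alpha> ** mat_powr \<sigma> (1 - \<alpha>)))"
proof -
  define t where "t = Re (trace (mat_powr \<rho> \<alpha> ** mat_powr \<sigma> (1 - \<alpha>)))"
  obtain a b where ab: "0 \<le> a" "0 \<le> b" "a \<noteq> 0 \<or> b \<noteq> 0"
    and sep: "\<And>P. loewner_le 0 P \<Longrightarrow> loewner_le P (mat 1) \<Longrightarrow>
      a * \<epsilon> + b * \<beta> \<le> a * (1 - Re (trace (P ** \<rho>))) + b * Re (trace (P ** \<sigma>))"
    using error_tradeoff_hyperplane[of \<epsilon> \<rho> \<beta> \<sigma>] le by metis
  have "psd \<rho>" and tr: "trace \<rho> = 1"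
    using \<rho> by (simp_all add: density_op_def)
  then obtain P where "loewner_le 0 P" "loewner_le P (mat 1)"
    "a * (Re (trace \<rho>) - Re (trace (P ** \<rho>))) + b * Re (trace (P ** \<sigma>))
      \<le> a powr \<alpha> * b powr (1 - \<alpha>) * t"
    using weighted_test_error_le[of \<rho> \<sigma> \<alpha> a b] \<sigma> \<alpha> ab unfolding t_def by metis
  with sep[of P] have main: "a * \<epsilon> + b * \<beta> \<le> a powr \<alpha> * b powr (1 - \<alpha>) * t"
    by (simp add: tr)
  \<comment> \<open>A zero weight would make the right-hand side of \<open>main\<close> vanish, as
    \<open>0 powr\<close> anything is 0, while the left-hand side is positive.\<close>
  have "a * \<epsilon> + b * \<beta> > 0"
    using ab \<epsilon> \<beta> by (cases "a = 0") (auto intro: add_pos_nonneg)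
  with main have "a \<noteq> 0" "b \<noteq> 0"
    by auto
  with ab have ab: "a > 0" "b > 0"
    by simp_all
  define p where "p = a powr \<alpha> * b powr (1 - \<alpha>)"
  have p: "p > 0"
    using ab by (simp add: p_def)
  \<comment> \<open>The divisors \<open>\<alpha>\<close> and \<open>1 - \<alpha>\<close> cancel the
    AM-GM weights, so that the arithmetic mean is exactly
    \<open>a * \<epsilon> + b * \<beta>\<close>.\<close>
  have "p * ((\<epsilon> / \<alpha>) powr \<alpha> * (\<beta> / (1 - \<alpha>)) powr (1 - \<alpha>))
      = (a * (\<epsilon> / \<alpha>)) powr \<alpha> * (b * (\<beta> / (1 - \<alpha>))) powr (1 - \<alpha>)"
    using ab \<epsilon> \<beta> \<alpha> by (simp only: p_def powr_mult mult_ac less_imp_le divide_nonneg_pos diff_gt_0_iff_gt)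
  also have "\<dots> \<le> \<alpha> * (a * (\<epsilon> / \<alpha>)) + (1 - \<alpha>) * (b * (\<beta> / (1 - \<alpha>)))"
    using ab \<epsilon> \<beta> \<alpha> by (intro Youngs_inequality_0) auto
  also have "\<dots> = a * \<epsilon> + b * \<beta>"
    using \<alpha> by simp
  also have "\<dots> \<le> p * t"
    using main by (simp add: p_def)
  finally show ?thesis
    using p by (simp add: t_def)
qed

theorem lemma6:
  fixes \<rho> \<sigma> :: "complex^'n^'n" and \<epsilon> \<alpha> :: real
  assumes "0 < \<epsilon>" and "\<epsilon> < 1"
    and "density_op \<rho>" and "density_op \<sigma>"
    and "0 < \<alpha>" and "\<alpha> < 1"
  shows "hypothesis_testing_entropy \<epsilon> \<rho> \<sigma>
       \<ge> petz_renyi \<alpha> \<rho> \<sigma>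
         + ereal (\<alpha> / (1 - \<alpha>) * (binary_entropy \<alpha> / \<alpha> - log 2 (1 / \<epsilon>)))"
proof -
  define S where "S = {Re (trace (P ** \<sigma>)) | P.
       loewner_le 0 P \<and> loewner_le P (mat 1) \<and> Re (trace (P ** \<rho>)) \<ge> 1 - \<epsilon>}"
  define \<beta> where "\<beta> = Inf S"
  have \<sigma>: "psd \<sigma>"
    using assms by (simp add: density_op_def)
  have nonneg: "0 \<le> x" if "x \<in> S" for x
    using that trace_mult_nonneg[OF _ \<sigma>] by (auto simp: S_def loewner_le_def)
  have lower: "\<beta> \<le> x" if "x \<in> S" for x
    unfolding \<beta>_def using that nonneg by (intro cInf_lower bdd_belowI) auto
  \<comment> \<open>The identity is a feasible test, so \<open>S\<close> is nonempty and its infimum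
    is meaningful.\<close>
  have "Re (trace (mat 1 ** \<sigma>)) \<in> S"
    using assms unfolding S_def
    by (intro CollectI exI[of _ "mat 1"]) (simp add: loewner_le_def psd_one psd_zero density_op_def)
  then have "\<beta> \<ge> 0"
    unfolding \<beta>_def using nonneg by (intro cInf_greatest) auto
  show ?thesis
  proof (cases "\<beta> = 0")
    \<comment> \<open>The entropy on the left is then \<open>\<infinity>\<close>.\<close>
    case True
    then show ?thesis
      by (simp add: hypothesis_testing_entropy_def neg_log2_def flip: S_def \<beta>_def)
  next
    case False
    with \<open>\<beta> \<ge> 0\<close> have \<beta>: "\<beta> > 0" by simp
    define t where "t = Re (trace (mat_powr \<rho> \<alpha> ** mat_powr \<sigma> (1 - \<alpha>)))"
    define L where "L = (\<epsilon> / \<alpha>) powr \<alpha> * (\<beta> / (1 - \<alpha>)) powr (1 - \<alpha>)"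
    have "L \<le> t"
      unfolding L_def t_def
      by (rule type_two_error_bound) (use assms \<sigma> \<beta> lower in \<open>auto simp: S_def\<close>)
    moreover have L: "L > 0"
      using assms \<beta> by (simp add: L_def)
    \<comment> \<open>Positivity of \<open>t\<close> selects the finite branch of
      \<open>petz_renyi\<close>.\<close>
    ultimately have t: "t > 0" and log_le: "log 2 L \<le> log 2 t"
      by simp_all
    \<comment> \<open>The summands involving only \<open>\<alpha>\<close> assemble into
      \<open>binary_entropy \<alpha>\<close>.\<close>
    have "log 2 L = \<alpha> * (log 2 \<epsilon> - log 2 \<alpha>) + (1 - \<alpha>) * (log 2 \<beta> - log 2 (1 - \<alpha>))"
      using assms \<beta> by (simp add: L_def log_mult log_powr log_divide)
    also have "\<dots> = \<alpha> * log 2 \<epsilon> + (1 - \<alpha>) * log 2 \<beta> + binary_entropy \<alpha>"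
      by (simp add: binary_entropy_def algebra_simps)
    finally have "binary_entropy \<alpha> + \<alpha> * log 2 \<epsilon> - log 2 t \<le> (1 - \<alpha>) * (- log 2 \<beta>)"
      using log_le by (simp add: algebra_simps)
    then have "(binary_entropy \<alpha> + \<alpha> * log 2 \<epsilon> - log 2 t) / (1 - \<alpha>) \<le> - log 2 \<beta>"
      using assms by (simp add: pos_divide_le_eq mult.commute)
    moreover have "1 / (\<alpha> - 1) * log 2 t + \<alpha> / (1 - \<alpha>) * (binary_entropy \<alpha> / \<alpha> - log 2 (1 / \<epsilon>))
        = (binary_entropy \<alpha> + \<alpha> * log 2 \<epsilon> - log 2 t) / (1 - \<alpha>)"
    proof -
      have "1 / (\<alpha> - 1) = - (1 / (1 - \<alpha>))"
        by (metis minus_diff_eq divide_minus_right)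
      moreover have "\<alpha> * (binary_entropy \<alpha> / \<alpha> - log 2 (1 / \<epsilon>)) = binary_entropy \<alpha> + \<alpha> * log 2 \<epsilon>"
        using assms by (simp add: log_divide distrib_left)
      ultimately show ?thesis
        by (simp add: diff_divide_distrib)
    qed
    ultimately show ?thesis
      using t \<beta> by (simp add: hypothesis_testing_entropy_def petz_renyi_def neg_log2_def Let_def
          flip: S_def \<beta>_def t_def)
  qed
qed

end
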